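(* Let $L\in\mathbb{R}^{n\times n}$ be a graph Laplacian matrix corresponding to an undirected connected graph, let $A=-L$, and let $T>0$. Then, for each of the two objective functions $h=f_T$ and $h=g_T$, the problem of minimizing $h(p)$ subject to $p\in X_T\cap\Delta$ has a unique solution; that is, there exists exactly one $p^*\in X_T\cap\Delta$ such that $h(p^* )\le h(p)$ for all $p\in X_T\cap\Delta$.
   Context: For $A\in\mathbb{R}^{n\times n}$, $T>0$ and $i=1,\dots,n$ put $W_i(T) := \int_0^T \exp(At)\, e_i e_i^\top \exp(A^\top t)\, dt$, where $e_i\in\mathbb{R}^n$ is the $i$-th standard basis vector. For $p=(p_1,\dots,p_n)\in\mathbb{R}^n$ put $W_{\rm con}(p,T) := \sum_{i=1}^n p_i W_i(T)$. Let $X_T := \{p\in\mathbb{R}^n \mid W_{\rm con}(p,T)\succ O\}$ (positive definite) and $\Delta := \{p\in\mathbb{R}^n \mid \sum_{i=1}^n p_i = 1,\ p_i\ge 0 \ (i=1,\dots,n)\}$. On $X_T$ define $f_T(p) := -\log\det W_{\rm con}(p,T)$ and $g_T(p) := \operatorname{tr}(W_{\rm con}(p,T)^{-1})$. *)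

theory Defs
  imports "HOL-Analysis.Analysis" "Graph_Theory.Pair_Digraph" "Graph_Theory.Digraph_Component"
begin

text \<open>
  The library multiplies vectors and matrices componentwise with \<^verbatim>\<open>*\<close>, so its power
  function does not give matrix powers, and its exponential function is not available on this type.
\<close>

definition matrix_power :: "real^'n^'n \<Rightarrow> nat \<Rightarrow> real^'n^'n" where
  "matrix_power A k = (((**) A) ^^ k) (mat 1)"

definition matrix_exp :: "real^'n^'n \<Rightarrow> real^'n^'n" where
  "matrix_exp A = (\<Sum>k. (1 / fact k) *\<^sub>R matrix_power A k)"

definition outer_product :: "real^'n \<Rightarrow> real^'n \<Rightarrow> real^'n^'n" where
  "outer_product x y = (\<chi> i j. x $ i * y $ j)"

definition positive_definite :: "real^'n^'n \<Rightarrow> bool" where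
  "positive_definite M \<longleftrightarrow> transpose M = M \<and> (\<forall>x. x \<noteq> 0 \<longrightarrow> x \<bullet> (M *v x) > 0)"

definition W_single :: "real^'n^'n \<Rightarrow> 'n \<Rightarrow> real \<Rightarrow> real^'n^'n" where
  "W_single A i T = integral {0..T}
     (\<lambda>t. matrix_exp (t *\<^sub>R A) ** outer_product (axis i 1) (axis i 1) **
          matrix_exp (t *\<^sub>R transpose A))"

definition W_con :: "real^'n^'n \<Rightarrow> real^'n \<Rightarrow> real \<Rightarrow> real^'n^'n" where
  "W_con A p T = (\<Sum>i\<in>UNIV. p $ i *\<^sub>R W_single A i T)"

definition X_T :: "real^'n^'n \<Rightarrow> real \<Rightarrow> (real^'n) set" where
  "X_T A T = {p. positive_definite (W_con A p T)}"

definition Delta :: "(real^'n) set" where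
  "Delta = {p. (\<Sum>i\<in>UNIV. p $ i) = 1 \<and> (\<forall>i. p $ i \<ge> 0)}"

definition f_T :: "real^'n^'n \<Rightarrow> real \<Rightarrow> real^'n \<Rightarrow> real" where
  "f_T A T p = - ln (det (W_con A p T))"

definition g_T :: "real^'n^'n \<Rightarrow> real \<Rightarrow> real^'n \<Rightarrow> real" where
  "g_T A T p = trace (matrix_inv (W_con A p T))"

text \<open>
  An undirected graph is represented, as usual in the graph library, by a symmetric set of arcs.
  The graph may carry edge weights; the Laplacian is the weighted degree matrix minus the weighted
  adjacency matrix.  The unweighted Laplacian is the case of all weights equal to 1.
\<close>

definition graph_laplacian :: "'n::finite pair_pre_digraph \<Rightarrow> ('n \<Rightarrow> 'n \<Rightarrow> real) \<Rightarrow> real^'n^'n" where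
  "graph_laplacian G w =
     (\<chi> i j. (if i = j then (\<Sum>k | (i, k) \<in> parcs G. w i k) else 0)
           - (if (i, j) \<in> parcs G then w i j else 0))"

definition edge_weights :: "'n pair_pre_digraph \<Rightarrow> ('n \<Rightarrow> 'n \<Rightarrow> real) \<Rightarrow> bool" where
  "edge_weights G w \<longleftrightarrow> (\<forall>(i, j) \<in> parcs G. w i j > 0 \<and> w j i = w i j)"

lemma edge_weights_one: "edge_weights G (\<lambda>_ _. 1)"
  by (auto simp: edge_weights_def)

lemma graph_laplacian_unweighted:
  fixes G :: "'n::finite pair_pre_digraph"
  assumes "pair_graph G"
  shows "graph_laplacian G (\<lambda>_ _. 1) $ i $ j =
    (if i = j then real (out_degree (with_proj G) i) else if (i, j) \<in> parcs G then - 1 else 0)"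
proof -
  interpret pair_graph G by fact
  have "out_arcs (with_proj G) i = Pair i ` {k. (i, k) \<in> parcs G}"
    by (auto simp: out_arcs_def with_proj_def)
  then have "out_degree (with_proj G) i = card {k. (i, k) \<in> parcs G}"
    by (simp add: out_degree_def card_image inj_on_def)
  moreover have "(i, i) \<notin> parcs G" using pair_no_loops by fastforce
  ultimately show ?thesis by (auto simp: graph_laplacian_def)
qed

end

theory Submission
  imports Defs
begin

text \<open>
  \<open>W_con A p T\<close> is linear in \<open>p\<close> and positive semidefinite on the simplex.  It is also injective
  in \<open>p\<close> when \<open>A\<close> is symmetric: pairing it with \<open>D = diag p\<close> gives the integral over \<open>t\<close> of the
  squared Frobenius norm of \<open>exp (t A / 2) D exp (t A / 2)\<close>, whose integrand at \<open>t = 0\<close>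
  is \<open>\<Sum>i. (p $ i)\<^sup>2\<close>.  Since \<open>- ln det\<close> and \<open>trace \<circ> inverse\<close> are strictly midpoint convex on
  positive definite matrices, minimizers are unique.  They exist by compactness: \<open>det\<close> attains a
  positive maximum on the simplex, and \<open>y \<bullet> y \<le> trace (inverse M) * (y \<bullet> M y)\<close> keeps the sublevel
  sets of the trace away from the singular matrices.
\<close>

section \<open>Positive definite matrices\<close>

definition positive_semidefinite :: "real^'n^'n \<Rightarrow> bool" where
  "positive_semidefinite M \<longleftrightarrow> transpose M = M \<and> (\<forall>x. x \<bullet> (M *v x) \<ge> 0)"

lemma positive_definite_imp_semidefinite:
  "positive_definite M \<Longrightarrow> positive_semidefinite M"
  unfolding positive_definite_def positive_semidefinite_def
  by (metis inner_zero_left less_eq_real_def)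

lemma symmetric_inner_mult:
  fixes M :: "real^'n^'n"
  assumes "transpose M = M"
  shows "(M *v x) \<bullet> y = x \<bullet> (M *v y)"
  by (metis assms dot_lmul_matrix transpose_matrix_vector)

lemma quadratic_form_add:
  fixes M :: "real^'n^'n"
  assumes "transpose M = M"
  shows "(x + c *\<^sub>R y) \<bullet> (M *v (x + c *\<^sub>R y))
    = x \<bullet> (M *v x) + 2 * c * (x \<bullet> (M *v y)) + c^2 * (y \<bullet> (M *v y))"
proof -
  have "y \<bullet> (M *v x) = x \<bullet> (M *v y)"
    by (metis assms inner_commute symmetric_inner_mult)
  then show ?thesis
    by (simp add: matrix_vector_right_distrib matrix_vector_mult_scaleR inner_add_left
        inner_add_right power2_eq_square algebra_simps)
qed

text \<open>The form at \<open>x + t *\<^sub>R y\<close> is a quadratic polynomial in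
  \<open>t\<close> that never becomes negative, so its discriminant cannot be positive.
  Semidefiniteness allows a zero leading coefficient, hence the case split.\<close>

lemma positive_semidefinite_Cauchy_Schwarz:
  assumes "positive_semidefinite M"
  shows "(x \<bullet> (M *v y))^2 \<le> (x \<bullet> (M *v x)) * (y \<bullet> (M *v y))"
proof -
  let ?a = "x \<bullet> (M *v x)" and ?b = "x \<bullet> (M *v y)" and ?c = "y \<bullet> (M *v y)"
  have sym: "transpose M = M" and nonneg: "\<And>z. z \<bullet> (M *v z) \<ge> 0"
    using assms by (auto simp: positive_semidefinite_def)
  have q: "0 \<le> ?a + 2 * t * ?b + t^2 * ?c" for t
    using nonneg[of "x + t *\<^sub>R y"] by (simp add: quadratic_form_add[OF sym])
  show ?thesis
  proof (cases "?c = 0")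
    case True
    have "?b = 0"
    proof (rule ccontr)
      assume "?b \<noteq> 0"
      then show False
        \<comment> \<open>At this \<open>t\<close> the remaining affine function
          \<open>?a + 2 * t * ?b\<close> equals -1.\<close>
        using q[of "- (?a + 1) / (2 * ?b)"] True by (simp add: field_simps)
    qed
    then show ?thesis
      using True by simp
  next
    case False
    then have "?c > 0"
      using nonneg[of y] by simp
    \<comment> \<open>\<open>- ?b / ?c\<close> is the minimizer of the quadratic; the factor
      \<open>?c\<close> clears denominators.\<close>
    then have "0 \<le> (?a + 2 * (- ?b / ?c) * ?b + (- ?b / ?c)^2 * ?c) * ?c"
      using q[of "- ?b / ?c"] by simp
    also have "\<dots> = ?a * ?c - ?b^2"
      using \<open>?c > 0\<close> by (simp add: field_simps power2_eq_square)
    finally show ?thesis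
      by simp
  qed
qed

text \<open>Cauchy-Schwarz applied to \<open>M *v x\<close> and \<open>x\<close> bounds the square
  of \<open>(M *v x) \<bullet> (M *v x)\<close> by a product with a zero factor.\<close>

lemma positive_semidefinite_kernel:
  assumes "positive_semidefinite M" and "x \<bullet> (M *v x) = 0"
  shows "M *v x = 0"
proof -
  have "((M *v x) \<bullet> (M *v x))^2 \<le> 0"
    using positive_semidefinite_Cauchy_Schwarz[OF assms(1), of "M *v x" x] assms(2) by simp
  then show ?thesis
    by simp
qed

lemma positive_definite_add:
  assumes "positive_definite M" "positive_semidefinite N"
  shows "positive_definite (M + N)"
  using assms unfolding positive_definite_def positive_semidefinite_def
  by (auto simp: transpose_def vec_eq_iff matrix_vector_mult_add_rdistrib inner_add_right
      intro!: add_pos_nonneg)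

lemma positive_semidefinite_scaleR:
  assumes "positive_semidefinite M" "c \<ge> 0"
  shows "positive_semidefinite (c *\<^sub>R M)"
  using assms unfolding positive_semidefinite_def
  by (simp add: transpose_scalar flip: scaleR_matrix_vector_assoc)

lemma positive_definite_scaleR:
  assumes "positive_definite M" "c > 0"
  shows "positive_definite (c *\<^sub>R M)"
  using assms unfolding positive_definite_def
  by (simp add: transpose_scalar flip: scaleR_matrix_vector_assoc)

lemma positive_definite_mat_1: "positive_definite (mat 1 :: real^'n^'n)"
  by (simp add: positive_definite_def)

section \<open>Determinants of positive definite matrices\<close>

lemma positive_definite_det_nonzero:
  assumes "positive_definite M"
  shows "det M \<noteq> 0"
proof -
  have "\<forall>x. M *v x = 0 \<longrightarrow> x = 0"
    using assms unfolding positive_definite_def by (metis inner_zero_right less_irrefl)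
  then show ?thesis
    by (metis invertible_det_nz invertible_left_inverse matrix_left_invertible_ker)
qed

lemma continuous_on_det [continuous_intros]:
  fixes f :: "'a::topological_space \<Rightarrow> real^'n^'n"
  assumes "continuous_on S f"
  shows "continuous_on S (\<lambda>x. det (f x))"
  unfolding det_def by (intro continuous_intros assms)

lemma continuous_on_matrix_vector_mult_left [continuous_intros]:
  fixes f :: "'a::topological_space \<Rightarrow> real^'n^'m"
  assumes "continuous_on S f"
  shows "continuous_on S (\<lambda>x. f x *v v)"
  unfolding matrix_vector_mult_def by (intro continuous_intros assms)

text \<open>The segment from the identity to \<open>M\<close> consists of definite matrices, on
  which the determinant has no zero. It starts at 1, so by the intermediate value theorem it stays
  positive.\<close>

lemma positive_definite_det_pos:
  assumes "positive_definite M"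
  shows "det M > 0"
proof (rule ccontr)
  assume "\<not> det M > 0"
  define F where "F = (\<lambda>s. (1 - s) *\<^sub>R mat 1 + s *\<^sub>R M)"
  have pd: "positive_definite (F s)" if "0 \<le> s" "s \<le> 1" for s
  proof (cases "s = 1")
    case False
    then show ?thesis
      unfolding F_def using that assms
      by (intro positive_definite_add positive_definite_scaleR positive_semidefinite_scaleR
          positive_definite_mat_1 positive_definite_imp_semidefinite) auto
  qed (simp add: F_def assms)
  have "continuous_on {0..1} (\<lambda>s. det (F s))"
    unfolding F_def by (intro continuous_intros)
  moreover have "det (F 0) = 1" "det (F 1) = det M"
    by (simp_all add: F_def)
  ultimately obtain s where "0 \<le> s" "s \<le> 1" "det (F s) = 0"
    using IVT2'[of "\<lambda>s. det (F s)" 1 0 0] \<open>\<not> det M > 0\<close> by auto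
  then show False
    using pd positive_definite_det_nonzero by blast
qed

text \<open>A zero of the form would be a kernel vector. This places a maximizer of the determinant
  among the definite matrices.\<close>

lemma positive_semidefinite_det_nonzero_imp_definite:
  fixes M :: "real^'n^'n"
  assumes "positive_semidefinite M" "det M \<noteq> 0"
  shows "positive_definite M"
  unfolding positive_definite_def
proof (intro conjI allI impI)
  fix x :: "real^'n"
  assume "x \<noteq> 0"
  have "M *v x \<noteq> 0"
    using assms(2) \<open>x \<noteq> 0\<close>
    by (metis invertible_det_nz invertible_left_inverse matrix_left_invertible_ker)
  then have "x \<bullet> (M *v x) \<noteq> 0"
    using assms(1) positive_semidefinite_kernel by blast
  then show "x \<bullet> (M *v x) > 0"
    using assms(1) by (simp add: positive_semidefinite_def order_less_le)
qed (use assms in \<open>simp add: positive_semidefinite_def\<close>)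

section \<open>Inverses of positive definite matrices\<close>

lemma matrix_inv_mult:
  fixes M :: "real^'n^'n"
  assumes "det M \<noteq> 0"
  shows "M ** matrix_inv M = mat 1" "matrix_inv M ** M = mat 1"
proof -
  have "\<exists>B. M ** B = mat 1 \<and> B ** M = mat 1"
    using assms by (metis invertible_det_nz invertible_def)
  then have "M ** matrix_inv M = mat 1 \<and> matrix_inv M ** M = mat 1"
    unfolding matrix_inv_def by (rule someI_ex)
  then show "M ** matrix_inv M = mat 1" "matrix_inv M ** M = mat 1"
    by auto
qed

lemma positive_definite_mult_inv:
  assumes "positive_definite M"
  shows "M *v (matrix_inv M *v x) = x" "matrix_inv M *v (M *v x) = x"
  using matrix_inv_mult[OF positive_definite_det_nonzero[OF assms]]
  by (simp_all add: matrix_vector_mul_assoc)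

lemma positive_definite_matrix_inv:
  fixes M :: "real^'n^'n"
  assumes "positive_definite M"
  shows "positive_definite (matrix_inv M)"
  unfolding positive_definite_def
proof (intro conjI allI impI)
  note inv = matrix_inv_mult[OF positive_definite_det_nonzero[OF assms]]
  have sym: "transpose M = M"
    using assms by (simp add: positive_definite_def)
  have "M ** transpose (matrix_inv M) = mat 1"
    by (metis inv(2) matrix_transpose_mul sym transpose_mat)
  then show "transpose (matrix_inv M) = matrix_inv M"
    by (metis inv(2) matrix_mul_assoc matrix_mul_lid matrix_mul_rid)
  fix x :: "real^'n"
  assume "x \<noteq> 0"
  \<comment> \<open>Substituting \<open>x = M *v y\<close> turns the form of the inverse at
    \<open>x\<close> into the form of \<open>M\<close> at \<open>y\<close>.\<close>
  define y where "y = matrix_inv M *v x"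
  have x: "x = M *v y"
    by (simp add: y_def positive_definite_mult_inv[OF assms])
  then have "y \<noteq> 0"
    using \<open>x \<noteq> 0\<close> by auto
  then have "y \<bullet> (M *v y) > 0"
    using assms by (simp add: positive_definite_def)
  then show "x \<bullet> (matrix_inv M *v x) > 0"
    unfolding y_def[symmetric] using x by (simp add: inner_commute)
qed

section \<open>The trace of the inverse: strict convexity, a coercivity bound, continuity\<close>

lemma trace_eq_sum_inner:
  fixes M :: "real^'n^'n"
  shows "trace M = (\<Sum>i\<in>UNIV. axis i 1 \<bullet> (M *v axis i 1))"
  by (simp add: trace_def inner_axis' matrix_vector_mul_component inner_axis)

text \<open>Completing the square with \<open>y - inverse M x\<close> shows that
  \<open>x \<bullet> inverse M x\<close> is the maximum over \<open>y\<close> of the right-hand side.\<close>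

lemma inner_matrix_inv_ge:
  assumes "positive_definite M"
  shows "x \<bullet> (matrix_inv M *v x) \<ge> 2 * (x \<bullet> y) - y \<bullet> (M *v y)"
    and "M *v y \<noteq> x \<Longrightarrow> x \<bullet> (matrix_inv M *v x) > 2 * (x \<bullet> y) - y \<bullet> (M *v y)"
proof -
  let ?z = "matrix_inv M *v x"
  have sym: "transpose M = M"
    using assms by (simp add: positive_definite_def)
  have *: "(y + (-1) *\<^sub>R ?z) \<bullet> (M *v (y + (-1) *\<^sub>R ?z))
    = x \<bullet> ?z - (2 * (x \<bullet> y) - y \<bullet> (M *v y))"
    unfolding quadratic_form_add[OF sym]
    by (simp add: positive_definite_mult_inv[OF assms] inner_commute)
  show "x \<bullet> ?z \<ge> 2 * (x \<bullet> y) - y \<bullet> (M *v y)"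
    using * positive_definite_imp_semidefinite[OF assms]
    unfolding positive_semidefinite_def by (metis diff_ge_0_iff_ge)
  assume "M *v y \<noteq> x"
  then have "y + (-1) *\<^sub>R ?z \<noteq> 0"
    using positive_definite_mult_inv(1)[OF assms] by auto
  then show "x \<bullet> ?z > 2 * (x \<bullet> y) - y \<bullet> (M *v y)"
    using * assms unfolding positive_definite_def by (metis diff_gt_0_iff_gt)
qed

text \<open>For each basis vector \<open>x\<close>, the choice \<open>y = matrix_inv M *v x\<close>
  is optimal for \<open>M\<close>. Used in the lower bounds for both \<open>P\<close> and
  \<open>Q\<close>, it makes them add up to exactly twice the value for \<open>M\<close>, because
  \<open>P + Q = 2 *\<^sub>R M\<close>.\<close>

lemma trace_matrix_inv_midpoint_less:
  fixes P Q M :: "real^'n^'n"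
  assumes P: "positive_definite P" and Q: "positive_definite Q" and "P \<noteq> Q"
    and M: "P + Q = 2 *\<^sub>R M"
  shows "2 * trace (matrix_inv M) < trace (matrix_inv P) + trace (matrix_inv Q)"
proof -
  have "M = (1/2) *\<^sub>R (P + Q)"
    using M by simp
  then have pdM: "positive_definite M"
    using positive_definite_scaleR[OF positive_definite_add[OF P
          positive_definite_imp_semidefinite[OF Q]], of "1/2"] by simp
  let ?e = "\<lambda>i. axis i 1 :: real^'n"
  let ?y = "\<lambda>i. matrix_inv M *v ?e i"
  have sum2: "(2 * (x \<bullet> y) - y \<bullet> (P *v y)) + (2 * (x \<bullet> y) - y \<bullet> (Q *v y))
      = 2 * (x \<bullet> y)" if "y = matrix_inv M *v x" for x y
  proof -
    have "y \<bullet> (P *v y) + y \<bullet> (Q *v y) = y \<bullet> ((P + Q) *v y)"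
      by (simp add: matrix_vector_mult_add_rdistrib inner_add_right)
    also have "\<dots> = 2 * (y \<bullet> x)"
      unfolding M that by (simp add: positive_definite_mult_inv[OF pdM]
          flip: scaleR_matrix_vector_assoc)
    finally show ?thesis
      by (simp add: inner_commute)
  qed
  have le: "2 * (x \<bullet> (matrix_inv M *v x))
      \<le> x \<bullet> (matrix_inv P *v x) + x \<bullet> (matrix_inv Q *v x)" for x
    using inner_matrix_inv_ge(1)[OF P, of x "matrix_inv M *v x"]
      inner_matrix_inv_ge(1)[OF Q, of x "matrix_inv M *v x"] sum2[of _ x] by force
  \<comment> \<open>Strictness at one basis vector suffices. Equality at all of them says that
    \<open>matrix_inv M\<close> is a right inverse of \<open>P\<close>, so \<open>P = M\<close> and
    then \<open>P = Q\<close>.\<close>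
  have "\<exists>i. P *v ?y i \<noteq> ?e i"
  proof (rule ccontr)
    assume "\<not> ?thesis"
    then have "column i (P ** matrix_inv M) = column i (mat 1)" for i
      by (metis matrix_vector_mul_assoc matrix_vector_mult_basis matrix_vector_mul_lid)
    then have "P ** matrix_inv M = mat 1"
      by (simp add: column_def vec_eq_iff)
    then have "P = M"
      by (metis matrix_inv_mult(2) matrix_mul_assoc matrix_mul_lid matrix_mul_rid pdM
          positive_definite_det_nonzero)
    with M have "P = Q"
      by (simp add: scaleR_2)
    with \<open>P \<noteq> Q\<close> show False ..
  qed
  then obtain i where i: "P *v ?y i \<noteq> ?e i"
    by blast
  have less: "2 * (?e i \<bullet> ?y i)
      < ?e i \<bullet> (matrix_inv P *v ?e i) + ?e i \<bullet> (matrix_inv Q *v ?e i)"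
    using inner_matrix_inv_ge(2)[OF P i]
      inner_matrix_inv_ge(1)[OF Q, of "?e i" "?y i"] sum2[OF refl, of "?e i"] by linarith
  have "(\<Sum>i\<in>UNIV. 2 * (?e i \<bullet> ?y i))
    < (\<Sum>i\<in>UNIV. ?e i \<bullet> (matrix_inv P *v ?e i) + ?e i \<bullet> (matrix_inv Q *v ?e i))"
    by (rule sum_strict_mono_ex1) (use le less in auto)
  then show ?thesis
    by (simp add: trace_eq_sum_inner sum.distrib sum_distrib_left)
qed

text \<open>Cauchy-Schwarz for the form of \<open>M\<close>, applied to
  \<open>matrix_inv M *v axis i 1\<close> and \<open>y\<close>, bounds the square of the
  \<open>i\<close>-th coordinate of \<open>y\<close>; summing over \<open>i\<close> produces the
  trace. The bound keeps the smallest eigenvalue of \<open>M\<close> above the reciprocal of the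
  trace.\<close>

lemma norm_le_trace_matrix_inv:
  assumes "positive_definite M"
  shows "y \<bullet> y \<le> trace (matrix_inv M) * (y \<bullet> (M *v y))"
proof -
  note psd = positive_definite_imp_semidefinite[OF assms]
  have "(axis i 1 \<bullet> y)^2 \<le> (axis i 1 \<bullet> (matrix_inv M *v axis i 1)) * (y \<bullet> (M *v y))" for i
  proof -
    let ?x = "matrix_inv M *v axis i 1"
    have "axis i 1 \<bullet> y = ?x \<bullet> (M *v y)"
      using symmetric_inner_mult[of M ?x y] assms
      by (simp add: positive_definite_mult_inv[OF assms] positive_definite_def)
    moreover have "?x \<bullet> (M *v ?x) = axis i 1 \<bullet> ?x"
      by (simp add: positive_definite_mult_inv[OF assms] inner_commute)
    ultimately show ?thesis
      using positive_semidefinite_Cauchy_Schwarz[OF psd, of ?x y] by metis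
  qed
  then have "(\<Sum>i\<in>UNIV. (axis i 1 \<bullet> y)^2)
    \<le> (\<Sum>i\<in>UNIV. (axis i 1 \<bullet> (matrix_inv M *v axis i 1)) * (y \<bullet> (M *v y)))"
    by (intro sum_mono) auto
  then show ?thesis
    by (simp add: trace_eq_sum_inner sum_distrib_right inner_axis' inner_vec_def[of y y]
        power2_eq_square)
qed

text \<open>Quotients of determinants reduce continuity of the trace of the inverse to continuity of
  \<open>det\<close>.\<close>

lemma trace_matrix_inv_cramer:
  fixes M :: "real^'n^'n"
  assumes "det M \<noteq> 0"
  shows "trace (matrix_inv M)
    = (\<Sum>k\<in>UNIV. det (\<chi> i j. if j = k then axis k 1 $ i else M $ i $ j) / det M)"
proof -
  have "(matrix_inv M *v axis k 1) $ k
    = det (\<chi> i j. if j = k then axis k 1 $ i else M $ i $ j) / det M" for k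
    using cramer[OF assms, of "matrix_inv M *v axis k 1" "axis k 1"] matrix_inv_mult(1)[OF assms]
    by (simp add: matrix_vector_mul_assoc)
  then show ?thesis
    by (simp add: trace_eq_sum_inner inner_axis')
qed

lemma continuous_on_trace_matrix_inv:
  fixes f :: "'a::topological_space \<Rightarrow> real^'n^'n"
  assumes "continuous_on S f" and "\<And>x. x \<in> S \<Longrightarrow> det (f x) \<noteq> 0"
  shows "continuous_on S (\<lambda>x. trace (matrix_inv (f x)))"
proof -
  \<comment> \<open>The condition \<open>j = k\<close> selecting the replaced column does not depend
    on the point \<open>x\<close>.\<close>
  have if_cont: "continuous_on S (\<lambda>x. if P then c else g x)"
    if "continuous_on S g" for P and c :: real and g
    using that by (cases P) auto
  have "continuous_on S (\<lambda>x. \<Sum>k\<in>UNIV.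
      det (\<chi> i j. if j = k then axis k 1 $ i else f x $ i $ j) / det (f x))"
    using assms by (intro continuous_intros if_cont) auto
  then show ?thesis
    by (rule continuous_on_eq) (simp add: trace_matrix_inv_cramer assms(2))
qed

section \<open>Strict midpoint log-concavity of the determinant\<close>

lemma matrix_add_rdistrib:
  fixes A B :: "'a::semiring_1^'n^'m"
  shows "(A + B) ** C = A ** C + B ** C"
  by (simp add: matrix_matrix_mult_def vec_eq_iff sum.distrib distrib_right)

lemma matrix_diff_ldistrib:
  fixes A :: "'a::ring_1^'n^'m"
  shows "A ** (B - C) = A ** B - A ** C"
  by (simp add: matrix_matrix_mult_def vec_eq_iff sum_subtractf right_diff_distrib)

section \<open>Rank-one matrices and congruence\<close>

lemma outer_product_mult_vector: "outer_product u v *v x = (v \<bullet> x) *\<^sub>R u"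
  by (simp add: outer_product_def matrix_vector_mult_def inner_vec_def vec_eq_iff
      sum_distrib_left sum_distrib_right algebra_simps)

lemma positive_semidefinite_outer_product: "positive_semidefinite (outer_product u u)"
  unfolding positive_semidefinite_def
  by (auto simp: outer_product_mult_vector inner_commute)
    (simp add: outer_product_def transpose_def vec_eq_iff)

text \<open>Serves twice: to rotate a rank-one perturbation onto a coordinate axis, and to rewrite
  the Gramian integrand as an outer product of a column of the exponential.\<close>

lemma congruence_outer_product:
  fixes R :: "real^'n^'m"
  shows "R ** outer_product u u ** transpose R = outer_product (R *v u) (R *v u)"
  unfolding matrix_eq
proof
  fix x
  have "u \<bullet> (transpose R *v x) = (R *v u) \<bullet> x"
    by (metis dot_lmul_matrix inner_commute transpose_matrix_vector)
  then show "(R ** outer_product u u ** transpose R) *v x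
      = outer_product (R *v u) (R *v u) *v x"
    by (simp only: outer_product_mult_vector matrix_vector_mult_scaleR
        flip: matrix_vector_mul_assoc)
qed

lemma positive_definite_congruence:
  fixes B R :: "real^'n^'n"
  assumes "positive_definite B" "det R \<noteq> 0"
  shows "positive_definite (R ** B ** transpose R)"
  unfolding positive_definite_def
proof (intro conjI allI impI)
  show "transpose (R ** B ** transpose R) = R ** B ** transpose R"
    using assms(1) by (simp add: positive_definite_def matrix_transpose_mul matrix_mul_assoc)
  fix x :: "real^'n"
  assume "x \<noteq> 0"
  have "det (transpose R) \<noteq> 0"
    using assms(2) by simp
  then have "transpose R *v x \<noteq> 0"
    using \<open>x \<noteq> 0\<close> by (metis invertible_det_nz invertible_left_inverse matrix_left_invertible_ker)
  then have "(transpose R *v x) \<bullet> (B *v (transpose R *v x)) > 0"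
    using assms(1) by (simp add: positive_definite_def del: transpose_matrix_vector)
  then show "x \<bullet> ((R ** B ** transpose R) *v x) > 0"
    by (simp add: dot_lmul_matrix flip: matrix_vector_mul_assoc)
qed

text \<open>Adding \<open>s *\<^sub>R ?J\<close> changes only the diagonal entry at
  \<open>k\<close>, so the determinant is affine in \<open>s\<close>. Its slope is
  \<open>det C\<close>, where \<open>C\<close> is \<open>B\<close> with row \<open>k\<close>
  replaced by a basis vector; the slope is shown to be nonzero and nonnegative.\<close>

lemma det_add_axis_greater:
  fixes B :: "real^'n^'n"
  assumes "positive_definite B"
  shows "det (B + outer_product (axis k 1) (axis k 1)) > det B"
proof -
  let ?J = "outer_product (axis k 1) (axis k 1) :: real^'n^'n"
  define C where "C = (\<chi> i. if i = k then axis k 1 else B $ i)"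
  have affine: "det (B + s *\<^sub>R ?J) = det B + s * det C" for s
  proof -
    have "B + s *\<^sub>R ?J = (\<chi> i. if i = k then B $ i + s *s axis k 1 else B $ i)"
      by (simp add: vec_eq_iff outer_product_def axis_def)
    also have "det \<dots> = det (\<chi> i. if i = k then B $ i else B $ i)
        + det (\<chi> i. if i = k then s *s axis k 1 else B $ i)"
      by (rule det_row_add)
    also have "det (\<chi> i. if i = k then s *s axis k 1 else B $ i) = s * det C"
      unfolding C_def by (rule det_row_mul)
    finally show ?thesis
      by simp
  qed
  have "\<forall>x. C *v x = 0 \<longrightarrow> x = 0"
  proof (intro allI impI)
    fix x
    assume "C *v x = 0"
    then have Cx: "C $ i \<bullet> x = 0" for i
      by (metis matrix_vector_mul_component zero_index)
    \<comment> \<open>Row \<open>k\<close> of \<open>C\<close> gives \<open>x $ k = 0\<close>, the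
      other rows give \<open>(B *v x) $ i = 0\<close>; each product has a zero factor.\<close>
    have xBx: "x $ i * (B *v x) $ i = 0" for i
      using Cx[of i] by (auto simp: C_def inner_axis' matrix_vector_mul_component split: if_splits)
    then have "x \<bullet> (B *v x) = 0"
      by (simp only: inner_vec_def inner_real_def xBx sum.neutral_const)
    then show "x = 0"
      using assms unfolding positive_definite_def by (metis less_irrefl)
  qed
  then have "det C \<noteq> 0"
    by (metis invertible_det_nz invertible_left_inverse matrix_left_invertible_ker)
  moreover have "det C \<ge> 0"
  proof (rule ccontr)
    assume "\<not> det C \<ge> 0"
    \<comment> \<open>The zero of the affine function. With a negative slope it lies at
      \<open>s \<ge> 0\<close>, where the matrix is still definite.\<close>
    define s where "s = - det B / det C"
    have "s \<ge> 0"
      using positive_definite_det_pos[OF assms] \<open>\<not> det C \<ge> 0\<close>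
      by (simp add: s_def divide_nonneg_neg)
    then have "det (B + s *\<^sub>R ?J) > 0"
      by (intro positive_definite_det_pos positive_definite_add positive_semidefinite_scaleR
          positive_semidefinite_outer_product assms)
    then show False
      unfolding affine using \<open>\<not> det C \<ge> 0\<close> by (simp add: s_def)
  qed
  ultimately show ?thesis
    using affine[of 1] by simp
qed

text \<open>A scaled orthogonal map sends \<open>u\<close> to a basis vector, which reduces the claim to
  a determinant that is affine in one diagonal entry.\<close>

lemma det_add_outer_product_greater:
  fixes B :: "real^'n^'n"
  assumes B: "positive_definite B" and "u \<noteq> 0"
  shows "det (B + outer_product u u) > det B"
proof -
  fix k :: 'n
  have "norm u = norm (norm u *\<^sub>R axis k (1::real))"
    by simp
  then obtain f :: "real^'n \<Rightarrow> real^'n"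
    where f: "orthogonal_transformation f" "f u = norm u *\<^sub>R axis k 1"
    by (rule orthogonal_transformation_exists) (rule that)
  define R where "R = (1 / norm u) *\<^sub>R matrix f"
  have "matrix f *v u = f u"
    by (rule matrix_works)
      (use f(1) in \<open>simp add: orthogonal_transformation_def linear_def scalar_mult_eq_scaleR\<close>)
  then have Ru: "R *v u = axis k 1"
    using f(2) \<open>u \<noteq> 0\<close> by (simp add: R_def flip: scaleR_matrix_vector_assoc)
  have "det (matrix f) \<noteq> 0"
    using orthogonal_transformation_det[OF f(1)] by force
  then have detR: "det R \<noteq> 0"
    using scalar_invertible[of "1 / norm u" "matrix f"] \<open>u \<noteq> 0\<close>
    by (simp add: R_def invertible_det_nz)
  let ?B = "R ** B ** transpose R"
  have "R ** (B + outer_product u u) ** transpose R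
      = ?B + outer_product (axis k 1) (axis k 1)"
    by (simp add: matrix_add_ldistrib matrix_add_rdistrib congruence_outer_product Ru)
  then have "det ?B < det (R ** (B + outer_product u u) ** transpose R)"
    using det_add_axis_greater[OF positive_definite_congruence[OF B detR]] by metis
  \<comment> \<open>Congruence by \<open>R\<close> scales both determinants by the same positive
    factor.\<close>
  then have "(det R)\<^sup>2 * det B < (det R)\<^sup>2 * det (B + outer_product u u)"
    by (simp add: det_mul power2_eq_square mult_ac)
  then show ?thesis
    using detR by (simp add: mult_less_cancel_left_pos)
qed

text \<open>One step of the Cholesky decomposition splits off a rank-one summand and clears a row.\<close>

lemma positive_semidefinite_split_rank_one:
  fixes N :: "real^'n^'n"
  assumes N: "positive_semidefinite N" and "N \<noteq> 0"
  obtains u N' where "u \<noteq> 0" "positive_semidefinite N'" "N = outer_product u u + N'"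
    "{i. N' $ i \<noteq> 0} \<subset> {i. N $ i \<noteq> 0}"
proof -
  have sym: "transpose N = N"
    using N by (simp add: positive_semidefinite_def)
  then have entry: "N $ i $ j = N $ j $ i" for i j
    by (metis transpose_def vec_lambda_beta)
  have col: "N *v axis i 1 = N $ i" for i
    by (simp add: vec_eq_iff matrix_vector_mul_component inner_axis entry)
  have diag: "axis i 1 \<bullet> (N *v axis i 1) = N $ i $ i" for i
    by (simp add: col inner_axis')
  obtain i where "N $ i \<noteq> 0"
    using \<open>N \<noteq> 0\<close> by (auto simp: vec_eq_iff)
  \<comment> \<open>A zero diagonal entry is a zero of the form at \<open>axis i 1\<close>, which
    would force the whole row to vanish.\<close>
  then have "N $ i $ i \<noteq> 0"
    using positive_semidefinite_kernel[OF N, of "axis i 1"] diag[of i] col[of i] by auto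
  then have pos: "N $ i $ i > 0"
    using N diag[of i] unfolding positive_semidefinite_def by (metis order_less_le)
  \<comment> \<open>With this scaling \<open>outer_product u u\<close> agrees with \<open>N\<close>
    in row and column \<open>i\<close>, and \<open>N'\<close> is the Schur complement of the
    pivot.\<close>
  define u where "u = (1 / sqrt (N $ i $ i)) *\<^sub>R N $ i"
  define N' where "N' = N - outer_product u u"
  have uu: "u $ a * u $ b = N $ i $ a * N $ i $ b / N $ i $ i" for a b
    using pos by (simp add: u_def field_simps flip: power2_eq_square)
  have N'entry: "N' $ a $ b = N $ a $ b - N $ i $ a * N $ i $ b / N $ i $ i" for a b
    by (simp add: N'_def outer_product_def uu)
  show thesis
  proof
    show "u \<noteq> 0"
      using \<open>N $ i \<noteq> 0\<close> pos by (simp add: u_def)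
    show "N = outer_product u u + N'"
      by (simp add: N'_def)
    show "positive_semidefinite N'"
      unfolding positive_semidefinite_def
    proof (intro conjI allI)
      show "transpose N' = N'"
        by (simp add: vec_eq_iff transpose_def N'entry entry mult.commute)
      fix x
      have "u \<bullet> x = (x \<bullet> (N *v axis i 1)) / sqrt (N $ i $ i)"
        by (simp add: u_def col inner_commute)
      then have "(u \<bullet> x)\<^sup>2 = (x \<bullet> (N *v axis i 1))\<^sup>2 / N $ i $ i"
        using pos by (simp add: power_divide)
      \<comment> \<open>Semidefiniteness of the Schur complement is Cauchy-Schwarz against the pivot
        vector \<open>axis i 1\<close>.\<close>
      also have "\<dots> \<le> x \<bullet> (N *v x)"
        using positive_semidefinite_Cauchy_Schwarz[OF N, of x "axis i 1"] pos
        by (simp add: diag field_simps)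
      finally show "0 \<le> x \<bullet> (N' *v x)"
        by (simp add: N'_def matrix_vector_mult_diff_rdistrib outer_product_mult_vector
            inner_diff_right inner_commute power2_eq_square)
    qed
    have "N' $ i = 0"
      using pos by (simp add: vec_eq_iff N'entry)
    moreover have "N' $ a = 0" if "N $ a = 0" for a
      using that entry[of i a] by (simp add: vec_eq_iff N'entry)
    ultimately show "{i. N' $ i \<noteq> 0} \<subset> {i. N $ i \<noteq> 0}"
      using \<open>N $ i \<noteq> 0\<close> by blast
  qed
qed

text \<open>Induction on the number of nonzero rows of \<open>N\<close>: each step adds one rank-one
  summand, which strictly increases the determinant, and leaves a remainder with fewer nonzero
  rows.\<close>

lemma det_add_positive_semidefinite_greater:
  fixes B N :: "real^'n^'n"
  assumes "positive_definite B" "positive_semidefinite N" "N \<noteq> 0"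
  shows "det (B + N) > det B"
  using assms
proof (induction "card {i. N $ i \<noteq> 0}" arbitrary: B N rule: less_induct)
  case less
  obtain u N' where u: "u \<noteq> 0" and N': "positive_semidefinite N'" "N = outer_product u u + N'"
    and sub: "{i. N' $ i \<noteq> 0} \<subset> {i. N $ i \<noteq> 0}"
    using positive_semidefinite_split_rank_one[OF less.prems(2,3)] by metis
  let ?B = "B + outer_product u u"
  have B: "positive_definite ?B"
    by (intro positive_definite_add positive_semidefinite_outer_product less.prems)
  have "card {i. N' $ i \<noteq> 0} < card {i. N $ i \<noteq> 0}"
    using sub by (intro psubset_card_mono) auto
  then have "N' \<noteq> 0 \<Longrightarrow> det (?B + N') > det ?B"
    using less.hyps B N'(1) by blast
  then have "det (?B + N') \<ge> det ?B"
    by (cases "N' = 0") auto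
  then show ?case
    using det_add_outer_product_greater[OF less.prems(1) u] N'(2) by (simp add: add.assoc)
qed

text \<open>With \<open>P = M + D\<close> and \<open>Q = M - D\<close> the product
  \<open>P ** matrix_inv M ** Q\<close> equals \<open>M - D ** matrix_inv M ** D\<close>, so the claim follows from
  strict monotonicity of the determinant.\<close>

lemma det_midpoint_greater:
  fixes P Q M :: "real^'n^'n"
  assumes P: "positive_definite P" and Q: "positive_definite Q" and "P \<noteq> Q"
    and M: "P + Q = 2 *\<^sub>R M"
  shows "det P * det Q < (det M)\<^sup>2"
proof -
  have "M = (1/2) *\<^sub>R (P + Q)"
    using M by simp
  then have pdM: "positive_definite M"
    using positive_definite_scaleR[OF positive_definite_add[OF P
          positive_definite_imp_semidefinite[OF Q]], of "1/2"] by simp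
  note inv = matrix_inv_mult[OF positive_definite_det_nonzero[OF pdM]]
  note pd_inv = positive_definite_matrix_inv[OF pdM]
  define D where "D = P - M"
  have PD: "P = M + D" and QD: "Q = M - D"
    using M by (simp_all add: D_def algebra_simps scaleR_2)
  have symD: "transpose D = D"
    using P pdM by (simp add: D_def positive_definite_def transpose_def vec_eq_iff)
  have symM: "transpose M = M"
    using pdM by (simp add: positive_definite_def)
  define N where "N = D ** matrix_inv M ** D"
  have form_N: "x \<bullet> (N *v x) = (D *v x) \<bullet> (matrix_inv M *v (D *v x))" for x
    by (simp add: N_def symmetric_inner_mult[OF symD] matrix_vector_mul_assoc matrix_mul_assoc)
  have symN: "transpose N = N"
    using pd_inv by (simp add: N_def matrix_transpose_mul symD positive_definite_def
        matrix_mul_assoc)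
  have psdN: "positive_semidefinite N"
    using positive_definite_imp_semidefinite[OF pd_inv]
    by (simp add: positive_semidefinite_def symN form_N)
  have "N \<noteq> 0"
  proof
    assume "N = 0"
    have "D \<noteq> 0"
      using \<open>P \<noteq> Q\<close> by (auto simp: PD QD)
    then obtain x where "D *v x \<noteq> 0"
      unfolding matrix_eq by auto
    then have "x \<bullet> (N *v x) > 0"
      using pd_inv by (simp add: form_N positive_definite_def)
    then show False
      using \<open>N = 0\<close> by simp
  qed
  have factor: "P ** matrix_inv M ** Q = M - N"
    by (simp add: PD QD N_def matrix_add_ldistrib matrix_add_rdistrib
        inv matrix_diff_ldistrib flip: matrix_mul_assoc)
  have "positive_definite (M - N)"
    unfolding positive_definite_def
  proof (intro conjI allI impI)
    show "transpose (M - N) = M - N"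
      using symM symN by (simp add: transpose_def vec_eq_iff)
    fix x :: "real^'n"
    assume "x \<noteq> 0"
    \<comment> \<open>For fixed \<open>x\<close> this \<open>y\<close> minimizes the form of the
      block matrix with diagonal blocks \<open>M\<close> and off-diagonal blocks \<open>D\<close>;
      the minimum is the form of \<open>M - N\<close> at \<open>x\<close>. In the coordinates
      \<open>x + y\<close> and \<open>x - y\<close> the block form splits into forms of
      \<open>P\<close> and \<open>Q\<close>.\<close>
    define y where "y = - (matrix_inv M *v (D *v x))"
    have "M *v y = - (D *v x)"
      using matrix_vector_mult_scaleR[of M "-1" "matrix_inv M *v (D *v x)"]
      by (simp add: y_def positive_definite_mult_inv[OF pdM])
    then have My: "y \<bullet> (M *v y) = - (y \<bullet> (D *v x))"
      by simp
    have Nx: "x \<bullet> (N *v x) = - (y \<bullet> (D *v x))"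
      by (simp add: form_N y_def inner_commute)
    have sw: "x \<bullet> (D *v y) = y \<bullet> (D *v x)" "x \<bullet> (M *v y) = y \<bullet> (M *v x)"
      by (metis inner_commute symD symM symmetric_inner_mult)+
    have "2 * (x \<bullet> ((M - N) *v x))
      = (x + y) \<bullet> (P *v (x + y)) + (x - y) \<bullet> (Q *v (x - y))"
      by (simp add: PD QD matrix_vector_mult_diff_rdistrib matrix_vector_mult_add_rdistrib
          matrix_vector_right_distrib matrix_vector_mult_diff_distrib
          inner_add_left inner_add_right inner_diff_left inner_diff_right My Nx sw)
    \<comment> \<open>The vectors \<open>x + y\<close> and \<open>x - y\<close> cannot both vanish,
      as their sum is twice \<open>x\<close>.\<close>
    also have "\<dots> > 0"
    proof (cases "x + y = 0")
      case True
      then have "x - y = 2 *\<^sub>R x"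
        by (simp add: add_eq_0_iff scaleR_2)
      then have "x - y \<noteq> 0"
        using \<open>x \<noteq> 0\<close> by simp
      then show ?thesis
        using True Q by (simp add: positive_definite_def)
    next
      case False
      then show ?thesis
        using P positive_definite_imp_semidefinite[OF Q]
        by (auto simp: positive_definite_def positive_semidefinite_def intro: add_pos_nonneg)
    qed
    finally show "x \<bullet> ((M - N) *v x) > 0"
      by simp
  qed
  then have less: "det (M - N) < det M"
    using det_add_positive_semidefinite_greater[OF _ psdN \<open>N \<noteq> 0\<close>, of "M - N"] by simp
  have "det M * det (matrix_inv M) = 1"
    by (metis inv(1) det_mul det_I)
  moreover have "det P * det (matrix_inv M) * det Q = det (M - N)"
    by (metis factor det_mul)
  \<comment> \<open>Multiplying the factorization by \<open>det M\<close> cancels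
    \<open>det (matrix_inv M)\<close>.\<close>
  ultimately have "det P * det Q = det M * det (M - N)"
    by (metis mult.assoc mult.commute mult.left_neutral)
  then show ?thesis
    using less positive_definite_det_pos[OF pdM] by (simp add: power2_eq_square)
qed

section \<open>Minimization over a linear family of semidefinite matrices\<close>

text \<open>Strict midpoint convexity enters only as a feasible point that beats the average of two
  values; at two distinct minimizers such a point would undercut the minimum.\<close>

lemma unique_minimizer:
  fixes h :: "'a \<Rightarrow> real"
  assumes ex: "\<exists>p\<in>D. \<forall>q\<in>D. h p \<le> h q"
    and mid: "\<And>p q. p \<in> D \<Longrightarrow> q \<in> D \<Longrightarrow> p \<noteq> q \<Longrightarrow> \<exists>m\<in>D. 2 * h m < h p + h q"
  shows "\<exists>!p. p \<in> D \<and> (\<forall>q\<in>D. h p \<le> h q)"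
proof (rule ex_ex1I)
  show "\<exists>p. p \<in> D \<and> (\<forall>q\<in>D. h p \<le> h q)"
    using ex by blast
next
  fix p q
  assume p: "p \<in> D \<and> (\<forall>q\<in>D. h p \<le> h q)" and q: "q \<in> D \<and> (\<forall>p\<in>D. h q \<le> h p)"
  show "p = q"
  proof (rule ccontr)
    assume "p \<noteq> q"
    then obtain m where "m \<in> D" "2 * h m < h p + h q"
      using mid p q by blast
    moreover have "h p \<le> h m" "h q \<le> h m"
      using p q \<open>m \<in> D\<close> by blast+
    ultimately show False
      by linarith
  qed
qed

text \<open>Collects the properties of \<open>p \<mapsto> W_con A p T\<close> on the simplex from
  which both minimization results follow; \<open>definite_part\<close> below becomes the feasible
  set.\<close>

locale semidefinite_family =
  fixes W :: "'a::euclidean_space \<Rightarrow> real^'n^'n" and C :: "'a set"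
  assumes linear_W: "linear W" and inj_W: "inj W"
    and convex_C: "convex C" and compact_C: "compact C"
    and semidefinite: "p \<in> C \<Longrightarrow> positive_semidefinite (W p)"
    and ex_definite: "\<exists>p\<in>C. positive_definite (W p)"
begin

abbreviation "definite_part \<equiv> {p \<in> C. positive_definite (W p)}"

lemma continuous_W: "continuous_on S W"
  using linear_W by (simp add: linear_continuous_on linear_conv_bounded_linear)

lemma midpoint:
  assumes "p \<in> definite_part" "q \<in> definite_part"
  obtains m where "m \<in> definite_part" "W p + W q = 2 *\<^sub>R W m"
proof
  let ?m = "(1/2) *\<^sub>R p + (1/2) *\<^sub>R q"
  have Wm: "W ?m = (1/2) *\<^sub>R (W p + W q)"
    by (simp add: linear_add[OF linear_W] linear_scale[OF linear_W] scaleR_add_right)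
  then show "W p + W q = 2 *\<^sub>R W ?m"
    by simp
  have "?m \<in> C"
    using convexD[OF convex_C, of p q "1/2" "1/2"] assms by simp
  then show "?m \<in> definite_part"
    unfolding mem_Collect_eq Wm using assms
    by (auto intro!: positive_definite_scaleR positive_definite_add
        positive_definite_imp_semidefinite)
qed

lemma unique_minimizer_neg_ln_det:
  "\<exists>!p. p \<in> definite_part \<and> (\<forall>q\<in>definite_part. - ln (det (W p)) \<le> - ln (det (W q)))"
proof (rule unique_minimizer)
  obtain p0 where p0: "p0 \<in> C" "positive_definite (W p0)"
    using ex_definite by blast
  obtain p where p: "p \<in> C" "\<forall>q\<in>C. det (W q) \<le> det (W p)"
    using continuous_attains_sup[OF compact_C, of "\<lambda>p. det (W p)"] p0
      continuous_on_det[OF continuous_W] by blast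
  then have pos: "det (W p) > 0"
    using p0 positive_definite_det_pos by fastforce
  then have "p \<in> definite_part"
    using p(1) positive_semidefinite_det_nonzero_imp_definite[OF semidefinite] by simp
  moreover have "- ln (det (W p)) \<le> - ln (det (W q))" if "q \<in> definite_part" for q
    using that p(2) pos positive_definite_det_pos[of "W q"] by simp
  ultimately show "\<exists>p\<in>definite_part. \<forall>q\<in>definite_part. - ln (det (W p)) \<le> - ln (det (W q))"
    by blast
next
  fix p q
  assume pq: "p \<in> definite_part" "q \<in> definite_part" "p \<noteq> q"
  then obtain m where m: "m \<in> definite_part" "W p + W q = 2 *\<^sub>R W m"
    using midpoint by blast
  have pos: "det (W p) > 0" "det (W q) > 0" "det (W m) > 0"
    using pq m by (auto intro: positive_definite_det_pos)
  \<comment> \<open>Injectivity of \<open>W\<close> turns \<open>p \<noteq> q\<close> into distinct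
    matrices, which the strict inequality requires.\<close>
  have "det (W p) * det (W q) < (det (W m))\<^sup>2"
    using det_midpoint_greater[OF _ _ _ m(2)] pq inj_W by (auto simp: inj_eq)
  then have "ln (det (W p) * det (W q)) < ln ((det (W m))\<^sup>2)"
    using pos by simp
  then have "ln (det (W p)) + ln (det (W q)) < 2 * ln (det (W m))"
    using pos by (simp add: ln_mult ln_realpow)
  then show "\<exists>m\<in>definite_part. 2 * - ln (det (W m)) < - ln (det (W p)) + - ln (det (W q))"
    using m(1) by (intro bexI[of _ m]) auto
qed

lemma unique_minimizer_trace_inv:
  "\<exists>!p. p \<in> definite_part \<and>
    (\<forall>q\<in>definite_part. trace (matrix_inv (W p)) \<le> trace (matrix_inv (W q)))"
proof (rule unique_minimizer)
  obtain p0 where p0: "p0 \<in> C" "positive_definite (W p0)"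
    using ex_definite by blast
  define c where "c = trace (matrix_inv (W p0))"
  \<comment> \<open>A compact set containing the sublevel set of \<open>p0\<close> and staying inside the definite part.\<close>
  define K where "K = C \<inter> (\<Inter>y. {p. y \<bullet> y \<le> c * (y \<bullet> (W p *v y))})"
  have K_definite: "positive_definite (W p)" if "p \<in> K" for p
    unfolding positive_definite_def
  proof (intro conjI allI impI)
    have psd: "positive_semidefinite (W p)"
      using that semidefinite by (auto simp: K_def)
    then show "transpose (W p) = W p"
      by (simp add: positive_semidefinite_def)
    fix y :: "real^'n"
    assume "y \<noteq> 0"
    \<comment> \<open>A positive product excludes a zero form, and semidefiniteness excludes a
      negative one.\<close>
    then have "0 < c * (y \<bullet> (W p *v y))"
      using that by (auto simp: K_def intro: less_le_trans[of 0 "y \<bullet> y"])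
    moreover have "0 \<le> y \<bullet> (W p *v y)"
      using psd by (simp add: positive_semidefinite_def)
    ultimately show "0 < y \<bullet> (W p *v y)"
      by (metis mult_zero_right order_less_le)
  qed
  have sublevel: "q \<in> K" if "q \<in> definite_part" "trace (matrix_inv (W q)) \<le> c" for q
  proof -
    have "y \<bullet> y \<le> c * (y \<bullet> (W q *v y))" for y
    proof -
      have "y \<bullet> y \<le> trace (matrix_inv (W q)) * (y \<bullet> (W q *v y))"
        using norm_le_trace_matrix_inv that(1) by auto
      also have "\<dots> \<le> c * (y \<bullet> (W q *v y))"
        using that positive_definite_imp_semidefinite[of "W q"]
        by (intro mult_right_mono) (auto simp: positive_semidefinite_def)
      finally show ?thesis .
    qed
    then show ?thesis
      using that(1) by (auto simp: K_def)
  qed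
  have "closed {p. y \<bullet> y \<le> c * (y \<bullet> (W p *v y))}" for y
    by (intro closed_Collect_le continuous_intros continuous_W)
  then have "compact K"
    unfolding K_def by (intro compact_Int_closed compact_C closed_INT) auto
  moreover have "p0 \<in> K"
    using sublevel p0 by (simp add: c_def)
  moreover have "continuous_on K (\<lambda>p. trace (matrix_inv (W p)))"
    using K_definite positive_definite_det_nonzero
    by (intro continuous_on_trace_matrix_inv continuous_W) blast
  ultimately obtain p where p: "p \<in> K"
    "\<forall>q\<in>K. trace (matrix_inv (W p)) \<le> trace (matrix_inv (W q))"
    using continuous_attains_inf[of K "\<lambda>p. trace (matrix_inv (W p))"] by blast
  \<comment> \<open>A feasible \<open>q\<close> outside \<open>K\<close> has trace above
    \<open>c\<close>, the value at \<open>p0\<close>, which lies in \<open>K\<close>.\<close>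
  have "trace (matrix_inv (W p)) \<le> trace (matrix_inv (W q))" if "q \<in> definite_part" for q
    using p \<open>p0 \<in> K\<close> sublevel[OF that] unfolding c_def by force
  moreover have "p \<in> definite_part"
    using p(1) K_definite by (auto simp: K_def)
  ultimately show "\<exists>p\<in>definite_part. \<forall>q\<in>definite_part.
      trace (matrix_inv (W p)) \<le> trace (matrix_inv (W q))"
    by blast
next
  fix p q
  assume pq: "p \<in> definite_part" "q \<in> definite_part" "p \<noteq> q"
  then obtain m where m: "m \<in> definite_part" "W p + W q = 2 *\<^sub>R W m"
    using midpoint by blast
  have "2 * trace (matrix_inv (W m)) < trace (matrix_inv (W p)) + trace (matrix_inv (W q))"
    using trace_matrix_inv_midpoint_less[OF _ _ _ m(2)] pq inj_W by (auto simp: inj_eq)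
  then show "\<exists>m\<in>definite_part.
      2 * trace (matrix_inv (W m)) < trace (matrix_inv (W p)) + trace (matrix_inv (W q))"
    using m(1) by blast
qed

end

section \<open>The matrix exponential\<close>

lemma matrix_power_0 [simp]: "matrix_power A 0 = mat 1"
  by (simp add: matrix_power_def)

lemma matrix_power_Suc: "matrix_power A (Suc k) = A ** matrix_power A k"
  by (simp add: matrix_power_def)

lemma matrix_power_commute: "matrix_power A k ** A = A ** matrix_power A k"
proof (induction k)
  case (Suc k)
  then show ?case
    by (metis matrix_mul_assoc matrix_power_Suc)
qed simp

lemma matrix_power_transpose: "matrix_power (transpose A) k = transpose (matrix_power A k)"
  by (induction k) (simp_all add: matrix_power_Suc matrix_transpose_mul flip: matrix_power_commute)

lemma matrix_power_scaleR: "matrix_power (t *\<^sub>R A) k = t ^ k *\<^sub>R matrix_power A k"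
  by (induction k)
    (simp_all add: matrix_power_Suc matrix_scalar_ac flip: scalar_matrix_assoc)

text \<open>The sum of all absolute entries bounds every absolute row sum, so each multiplication by
  \<open>A\<close> costs at most a factor \<open>c\<close>. The exponential series is thereby
  dominated entrywise by a scalar one.\<close>

lemma matrix_power_entry_le:
  fixes A :: "real^'n^'n"
  defines "c \<equiv> \<Sum>i\<in>UNIV. \<Sum>j\<in>UNIV. \<bar>A $ i $ j\<bar>"
  shows "\<bar>matrix_power A k $ i $ j\<bar> \<le> c ^ k"
proof (induction k arbitrary: i)
  case 0
  then show ?case
    by (simp add: mat_def)
next
  case (Suc k)
  have "0 \<le> c"
    by (simp add: c_def sum_nonneg)
  have "\<bar>matrix_power A (Suc k) $ i $ j\<bar> \<le> (\<Sum>l\<in>UNIV. \<bar>A $ i $ l\<bar> * \<bar>matrix_power A k $ l $ j\<bar>)"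
    by (simp add: matrix_power_Suc matrix_matrix_mult_def sum_abs flip: abs_mult)
  also have "\<dots> \<le> (\<Sum>l\<in>UNIV. \<bar>A $ i $ l\<bar> * c ^ k)"
    by (intro sum_mono mult_left_mono Suc.IH) auto
  also have "\<dots> = (\<Sum>l\<in>UNIV. \<bar>A $ i $ l\<bar>) * c ^ k"
    by (simp add: sum_distrib_right)
  also have "\<dots> \<le> c * c ^ k"
  proof (rule mult_right_mono)
    show "(\<Sum>l\<in>UNIV. \<bar>A $ i $ l\<bar>) \<le> c"
      unfolding c_def
      by (rule member_le_sum[of i UNIV "\<lambda>i. \<Sum>l\<in>UNIV. \<bar>A $ i $ l\<bar>"])
        (auto intro: sum_nonneg)
  qed (simp add: \<open>0 \<le> c\<close>)
  finally show ?case
    by simp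
qed

lemma summable_matrix_exp_entry:
  "summable (\<lambda>k. matrix_power A k $ i $ j / fact k * t ^ k)"
proof (rule summable_comparison_test')
  let ?c = "\<Sum>i\<in>UNIV. \<Sum>j\<in>UNIV. \<bar>A $ i $ j\<bar>"
  show "summable (\<lambda>k. inverse (fact k) * (?c * \<bar>t\<bar>) ^ k)"
    by (rule summable_exp)
  show "norm (matrix_power A k $ i $ j / fact k * t ^ k) \<le> inverse (fact k) * (?c * \<bar>t\<bar>) ^ k"
    if "k \<ge> 0" for k
    using matrix_power_entry_le[of A k i j]
    by (simp add: abs_mult power_mult_distrib power_abs divide_simps mult_right_mono)
qed

text \<open>Each entry becomes a scalar power series in \<open>t\<close>, to which termwise
  differentiation applies.\<close>

lemma matrix_exp_entry:
  "matrix_exp (t *\<^sub>R A) $ i $ j = (\<Sum>k. matrix_power A k $ i $ j / fact k * t ^ k)"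
proof -
  let ?f = "\<lambda>k. (1 / fact k) *\<^sub>R matrix_power (t *\<^sub>R A) k"
  have "?f sums (\<chi> i j. \<Sum>k. matrix_power A k $ i $ j / fact k * t ^ k)"
    unfolding sums_def
  proof (intro vec_tendstoI)
    fix i j
    have "(\<lambda>k. matrix_power A k $ i $ j / fact k * t ^ k) sums
        (\<Sum>k. matrix_power A k $ i $ j / fact k * t ^ k)"
      by (rule summable_sums[OF summable_matrix_exp_entry])
    then show "(\<lambda>n. (\<Sum>k<n. ?f k) $ i $ j) \<longlonglongrightarrow>
        (\<chi> i j. \<Sum>k. matrix_power A k $ i $ j / fact k * t ^ k) $ i $ j"
      by (simp add: sums_def matrix_power_scaleR mult.commute)
  qed
  then show ?thesis
    unfolding matrix_exp_def by (simp flip: sums_unique)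
qed

lemma matrix_exp_0 [simp]: "matrix_exp (0 :: real^'n^'n) = mat 1"
proof -
  have "matrix_exp (0 *\<^sub>R (0 :: real^'n^'n)) $ i $ j = mat 1 $ i $ j" for i j
    unfolding matrix_exp_entry powser_zero by simp
  then show ?thesis
    by (simp add: vec_eq_iff)
qed

lemma matrix_exp_transpose:
  "matrix_exp (t *\<^sub>R transpose A) = transpose (matrix_exp (t *\<^sub>R A))"
  by (simp add: vec_eq_iff matrix_exp_entry matrix_power_transpose)
    (simp add: transpose_def matrix_exp_entry)

text \<open>Multiplication by \<open>A\<close> shifts the power by one but leaves the factorial,
  which is exactly the coefficient sequence of the differentiated series.\<close>

lemma matrix_exp_mult_entry:
  "(A ** matrix_exp (t *\<^sub>R A)) $ i $ j
    = (\<Sum>k. matrix_power A (Suc k) $ i $ j / fact k * t ^ k)"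
proof -
  let ?f = "\<lambda>l k. matrix_power A k $ l $ j / fact k * t ^ k"
  have "(A ** matrix_exp (t *\<^sub>R A)) $ i $ j = (\<Sum>l\<in>UNIV. A $ i $ l * (\<Sum>k. ?f l k))"
    by (simp add: matrix_matrix_mult_def matrix_exp_entry)
  also have "\<dots> = (\<Sum>l\<in>UNIV. \<Sum>k. A $ i $ l * ?f l k)"
    by (simp only: suminf_mult[OF summable_matrix_exp_entry])
  also have "\<dots> = (\<Sum>k. \<Sum>l\<in>UNIV. A $ i $ l * ?f l k)"
    by (rule suminf_sum[symmetric]) (rule summable_mult[OF summable_matrix_exp_entry])
  finally show ?thesis
    by (simp add: matrix_power_Suc matrix_matrix_mult_def sum_distrib_right sum_divide_distrib
        mult.assoc)
qed

text \<open>The series for left multiplication has coefficients compatible with transposition, so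
  transposing its instance for \<open>transpose A\<close> gives right multiplication.\<close>

lemma matrix_exp_commute:
  "matrix_exp (t *\<^sub>R A) ** A = A ** matrix_exp (t *\<^sub>R A)"
proof -
  have "A ** matrix_exp (t *\<^sub>R A)
      = transpose (transpose A ** matrix_exp (t *\<^sub>R transpose A))"
    unfolding vec_eq_iff transpose_def[of "_ ** _"] vec_lambda_beta matrix_exp_mult_entry
      matrix_power_transpose by (simp add: transpose_def)
  then show ?thesis
    by (simp add: matrix_exp_transpose matrix_transpose_mul)
qed

lemma has_derivative_matrix_exp:
  "((\<lambda>t. matrix_exp (t *\<^sub>R A) $ i $ j) has_real_derivative (A ** matrix_exp (t *\<^sub>R A)) $ i $ j)
    (at t)"
proof -
  have "diffs (\<lambda>k. matrix_power A k $ i $ j / fact k)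
      = (\<lambda>k. matrix_power A (Suc k) $ i $ j / fact k)"
    by (simp add: diffs_def fun_eq_iff divide_simps)
  then show ?thesis
    using termdiffs_strong_converges_everywhere[of "\<lambda>k. matrix_power A k $ i $ j / fact k" t,
        OF summable_matrix_exp_entry]
    by (simp add: matrix_exp_entry matrix_exp_mult_entry)
qed

lemma continuous_on_matrix_exp [continuous_intros]:
  "continuous_on S (\<lambda>t. matrix_exp (t *\<^sub>R A))"
proof -
  have "continuous_on S (\<lambda>t. \<chi> i j. matrix_exp (t *\<^sub>R A) $ i $ j)"
    by (intro continuous_on_vec_lambda continuous_at_imp_continuous_on ballI
        DERIV_isCont[OF has_derivative_matrix_exp])
  then show ?thesis
    by (simp add: vec_lambda_eta)
qed

text \<open>The product of the exponentials at \<open>u\<close> and \<open>s + t - u\<close> has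
  derivative zero in \<open>u\<close>, since \<open>A\<close> commutes with its exponential.
  Comparing \<open>u = s\<close> with \<open>u = 0\<close> gives the claim.\<close>

lemma matrix_exp_add:
  "matrix_exp ((s + t) *\<^sub>R A) = matrix_exp (s *\<^sub>R A) ** matrix_exp (t *\<^sub>R A)"
proof -
  let ?E = "\<lambda>u. matrix_exp (u *\<^sub>R A)"
  have "(?E s ** ?E t) $ i $ j = ?E (s + t) $ i $ j" for i j
  proof -
    let ?\<phi> = "\<lambda>u. (?E u ** ?E (s + t - u)) $ i $ j"
    have "(?\<phi> has_real_derivative 0) (at u)" for u
    proof -
      let ?v = "s + t - u"
      have d2: "((\<lambda>u. ?E (s + t - u) $ l $ j) has_real_derivative - (A ** ?E ?v) $ l $ j) (at u)"
        for l
      proof -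
        have "((\<lambda>u. s + t - u) has_real_derivative -1) (at u)"
          by (auto intro!: derivative_eq_intros)
        from DERIV_chain2[OF has_derivative_matrix_exp[of A l j] this] show ?thesis
          by simp
      qed
      have "(?\<phi> has_real_derivative
          (\<Sum>l\<in>UNIV. (A ** ?E u) $ i $ l * ?E ?v $ l $ j + - (A ** ?E ?v) $ l $ j * ?E u $ i $ l))
          (at u)"
        unfolding matrix_matrix_mult_def[of "?E _" "?E _"] vec_lambda_beta
        by (intro DERIV_sum DERIV_mult has_derivative_matrix_exp d2)
      also have "(\<Sum>l\<in>UNIV. (A ** ?E u) $ i $ l * ?E ?v $ l $ j + - (A ** ?E ?v) $ l $ j * ?E u $ i $ l)
          = ((A ** ?E u) ** ?E ?v - ?E u ** (A ** ?E ?v)) $ i $ j"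
        unfolding matrix_matrix_mult_def[of "A ** ?E u"] matrix_matrix_mult_def[of "?E u" "A ** _"]
        by (simp add: sum_subtractf mult.commute)
      also have "\<dots> = 0"
        by (simp add: matrix_mul_assoc matrix_exp_commute)
      finally show ?thesis .
    qed
    then have "?\<phi> s = ?\<phi> 0"
      by (intro DERIV_isconst_all) auto
    then show ?thesis
      by simp
  qed
  then show ?thesis
    by (simp add: vec_eq_iff)
qed

section \<open>Controllability Gramians\<close>

lemma continuous_on_outer_product [continuous_intros]:
  assumes "continuous_on S f" "continuous_on S g"
  shows "continuous_on S (\<lambda>x. outer_product (f x) (g x))"
  unfolding outer_product_def using assms by (intro continuous_intros)

text \<open>Stated for an arbitrary linear functional so that matrix entries and quadratic forms of
  the Gramian both follow from one exchange with the integral.\<close>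

lemma W_single_linear_image:
  fixes A :: "real^'n^'n" and \<phi> :: "real^'n^'n \<Rightarrow> real"
  assumes "linear \<phi>"
  shows "\<phi> (W_single A i T) = integral {0..T}
    (\<lambda>t. \<phi> (outer_product (column i (matrix_exp (t *\<^sub>R A))) (column i (matrix_exp (t *\<^sub>R A)))))"
proof -
  let ?f = "\<lambda>t. outer_product (matrix_exp (t *\<^sub>R A) *v axis i 1)
    (matrix_exp (t *\<^sub>R A) *v axis i 1)"
  have W: "W_single A i T = integral {0..T} ?f"
    by (simp add: W_single_def matrix_exp_transpose congruence_outer_product)
  have "?f integrable_on {0..T}"
    by (intro integrable_continuous_real continuous_intros)
  then have "integral {0..T} (\<phi> \<circ> ?f) = \<phi> (W_single A i T)"
    unfolding W by (rule integral_linear) (use assms linear_conv_bounded_linear in blast)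
  then show ?thesis
    by (simp add: o_def matrix_vector_mult_basis)
qed

lemma W_single_entry:
  "W_single A i T $ j $ k = integral {0..T}
    (\<lambda>t. matrix_exp (t *\<^sub>R A) $ j $ i * matrix_exp (t *\<^sub>R A) $ k $ i)"
  using W_single_linear_image[of "\<lambda>M. M $ j $ k" A i T]
  by (simp add: linear_iff outer_product_def column_def)

lemma W_single_form:
  "x \<bullet> (W_single A i T *v x) = integral {0..T} (\<lambda>t. (x \<bullet> column i (matrix_exp (t *\<^sub>R A)))\<^sup>2)"
proof -
  have "linear (\<lambda>M. x \<bullet> (M *v x))"
    by (simp add: linear_iff matrix_vector_mult_add_rdistrib inner_add_right
        flip: scaleR_matrix_vector_assoc)
  from W_single_linear_image[OF this, of A i T] show ?thesis
    by (simp add: outer_product_mult_vector power2_eq_square inner_commute)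
qed

lemma positive_semidefinite_W_single: "positive_semidefinite (W_single A i T)"
  unfolding positive_semidefinite_def
proof (intro conjI allI)
  show "transpose (W_single A i T) = W_single A i T"
    by (simp add: vec_eq_iff transpose_def W_single_entry mult.commute)
  fix x
  show "0 \<le> x \<bullet> (W_single A i T *v x)"
    unfolding W_single_form
    \<comment> \<open>A function that is not integrable has integral 0 by convention, so both cases
      give a nonnegative value.\<close>
    by (cases "(\<lambda>t. (x \<bullet> column i (matrix_exp (t *\<^sub>R A)))\<^sup>2) integrable_on {0..T}")
      (auto intro: integral_nonneg simp: not_integrable_integral)
qed

text \<open>A continuous nonnegative integrand with zero integral vanishes everywhere, in particular
  at \<open>t = 0\<close>, where the exponential is the identity.\<close>

lemma W_single_form_eq_0:
  assumes "T > 0" "x \<bullet> (W_single A i T *v x) = 0"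
  shows "x $ i = 0"
proof -
  have "continuous_on {0..T} (\<lambda>t. (x \<bullet> column i (matrix_exp (t *\<^sub>R A)))\<^sup>2)"
    unfolding column_def by (intro continuous_intros)
  then have "\<forall>t\<in>{0..T}. (x \<bullet> column i (matrix_exp (t *\<^sub>R A)))\<^sup>2 = 0"
    using assms by (simp add: W_single_form integral_eq_0_iff)
  then have "x \<bullet> column i (matrix_exp (0 *\<^sub>R A)) = 0"
    using \<open>T > 0\<close> by (auto simp del: scaleR_zero_left)
  moreover have "column i (mat 1) = (axis i 1 :: real^'a)"
    by (simp add: column_def mat_def axis_def vec_eq_iff)
  ultimately show ?thesis
    by (simp add: inner_axis)
qed

lemma W_con_form: "x \<bullet> (W_con A p T *v x) = (\<Sum>i\<in>UNIV. p $ i * (x \<bullet> (W_single A i T *v x)))"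
proof -
  have "linear (\<lambda>M. x \<bullet> (M *v x))"
    by (simp add: linear_iff matrix_vector_mult_add_rdistrib inner_add_right
        flip: scaleR_matrix_vector_assoc)
  note lin = linear_sum[OF this] linear_scale[OF this]
  show ?thesis
    by (simp add: W_con_def lin)
qed

lemma transpose_W_con: "transpose (W_con A p T) = W_con A p T"
proof -
  have "W_single A i T $ j $ k = W_single A i T $ k $ j" for i j k
    by (simp add: W_single_entry mult.commute)
  then show ?thesis
    by (simp add: vec_eq_iff transpose_def W_con_def)
qed

lemma positive_semidefinite_W_con:
  assumes "\<And>i. p $ i \<ge> 0"
  shows "positive_semidefinite (W_con A p T)"
  using assms positive_semidefinite_W_single[of A _ T]
  by (auto simp: positive_semidefinite_def transpose_W_con W_con_form intro!: sum_nonneg)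

lemma positive_definite_W_con:
  assumes "T > 0" "\<And>i. p $ i > 0"
  shows "positive_definite (W_con A p T)"
  unfolding positive_definite_def
proof (intro conjI allI impI)
  show "transpose (W_con A p T) = W_con A p T"
    by (rule transpose_W_con)
  fix x :: "real^'a"
  assume "x \<noteq> 0"
  then obtain i where "x $ i \<noteq> 0"
    by (auto simp: vec_eq_iff)
  have nonneg: "0 \<le> x \<bullet> (W_single A j T *v x)" for j
    using positive_semidefinite_W_single[of A j T] by (simp add: positive_semidefinite_def)
  then have "0 < x \<bullet> (W_single A i T *v x)"
    using W_single_form_eq_0[OF \<open>T > 0\<close>, of x A i] \<open>x $ i \<noteq> 0\<close>
    by (auto simp: order_less_le)
  then have "0 < p $ i * (x \<bullet> (W_single A i T *v x))"
    using assms(2) by simp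
  then show "0 < x \<bullet> (W_con A p T *v x)"
    unfolding W_con_form
    by (rule sum_pos2[OF finite UNIV_I]) (simp add: nonneg assms(2) less_imp_le)
qed

section \<open>Linearity and injectivity of the Gramian in the weights\<close>

lemma linear_W_con: "linear (\<lambda>p. W_con A p T)"
  by (simp add: linear_iff W_con_def scaleR_add_left sum.distrib scaleR_sum_right)

lemma W_con_eq_0:
  fixes A :: "real^'n^'n"
  assumes sym: "transpose A = A" and "T > 0" and "W_con A p T = 0"
  shows "p = 0"
proof -
  let ?E = "\<lambda>t. matrix_exp (t *\<^sub>R A)"
  \<comment> \<open>For symmetric \<open>A\<close> this is the trace of \<open>D E D E\<close> with
    \<open>D = diag p\<close> and \<open>E\<close> the exponential at \<open>t\<close>.\<close>
  define \<psi> where "\<psi> t = (\<Sum>j\<in>UNIV. \<Sum>i\<in>UNIV. p $ j * (p $ i * (?E t $ j $ i * ?E t $ j $ i)))" for t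
  have symE: "?E t $ i $ j = ?E t $ j $ i" for t i j
    by (metis matrix_exp_transpose sym transpose_def vec_lambda_beta)
  \<comment> \<open>Writing \<open>E\<close> as the square of the half-time exponential
    \<open>F\<close> and using cyclicity of the trace gives the squared entries of
    \<open>F D F\<close>. The proof carries this out as a reordering of a fourfold sum.\<close>
  have "\<psi> t = (\<Sum>k\<in>UNIV. \<Sum>l\<in>UNIV. (\<Sum>i\<in>UNIV. p $ i * (?E (t/2) $ k $ i * ?E (t/2) $ l $ i))\<^sup>2)"
    for t
  proof -
    let ?F = "?E (t/2)"
    have EF: "?E t $ j $ i = (\<Sum>k\<in>UNIV. ?F $ k $ j * ?F $ k $ i)" for i j
      using matrix_exp_add[of "t/2" "t/2" A] symE[of "t/2" j]
      by (simp add: matrix_matrix_mult_def)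
    have "\<psi> t = (\<Sum>j\<in>UNIV. \<Sum>i\<in>UNIV. \<Sum>k\<in>UNIV. \<Sum>l\<in>UNIV.
        (p $ j * (?F $ k $ j * ?F $ l $ j)) * (p $ i * (?F $ k $ i * ?F $ l $ i)))"
      unfolding \<psi>_def EF unfolding sum_product unfolding sum_distrib_left
      by (simp add: mult_ac)
    also have "\<dots> = (\<Sum>k\<in>UNIV. \<Sum>l\<in>UNIV. \<Sum>j\<in>UNIV. \<Sum>i\<in>UNIV.
        (p $ j * (?F $ k $ j * ?F $ l $ j)) * (p $ i * (?F $ k $ i * ?F $ l $ i)))"
      unfolding sum.cartesian_product
      by (intro sum.reindex_bij_witness[of _ "\<lambda>(k, l, j, i). (j, i, k, l)"
            "\<lambda>(j, i, k, l). (k, l, j, i)"]) auto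
    finally show ?thesis
      by (simp add: power2_eq_square sum_product)
  qed
  then have nonneg: "\<psi> t \<ge> 0" for t
    by (simp add: sum_nonneg)
  \<comment> \<open>Pairing the zero Gramian with \<open>diag p\<close> involves its diagonal
    entries only and yields the integral of \<open>\<psi>\<close>.\<close>
  have "0 = (\<Sum>j\<in>UNIV. p $ j * W_con A p T $ j $ j)"
    using assms(3) by simp
  also have "\<dots> = (\<Sum>j\<in>UNIV. \<Sum>i\<in>UNIV. p $ j * (p $ i *
      integral {0..T} (\<lambda>t. ?E t $ j $ i * ?E t $ j $ i)))"
    by (simp add: W_con_def W_single_entry sum_distrib_left)
  also have "\<dots> = (\<Sum>j\<in>UNIV. \<Sum>i\<in>UNIV. integral {0..T}
      (\<lambda>t. p $ j * (p $ i * (?E t $ j $ i * ?E t $ j $ i))))"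
    by simp
  also have "\<dots> = integral {0..T} \<psi>"
  proof -
    have "(\<lambda>t. p $ j * (p $ i * (?E t $ j $ i * ?E t $ j $ i))) integrable_on {0..T}" for i j
      by (intro integrable_continuous_real continuous_intros)
    then show ?thesis
      unfolding \<psi>_def by (simp only: integral_sum integrable_sum finite)
  qed
  finally have "integral {0..T} \<psi> = 0"
    by simp
  moreover have "continuous_on {0..T} \<psi>"
    unfolding \<psi>_def by (intro continuous_intros)
  ultimately have "\<psi> 0 = 0"
    using integral_eq_0_iff[of 0 T \<psi>] \<open>T > 0\<close> nonneg by auto
  moreover have "p $ j * (p $ i * ((mat 1 :: real^'n^'n) $ j $ i * (mat 1 :: real^'n^'n) $ j $ i))
      = (if i = j then (p $ j)\<^sup>2 else 0)" for i j
    by (simp add: mat_def power2_eq_square)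
  ultimately have "(\<Sum>j\<in>UNIV. (p $ j)\<^sup>2) = 0"
    by (simp add: \<psi>_def)
  then show ?thesis
    by (simp add: sum_nonneg_eq_0_iff vec_eq_iff)
qed

lemma inj_W_con:
  assumes "transpose A = A" "T > 0"
  shows "inj (\<lambda>p. W_con A p T)"
  using W_con_eq_0[OF assms] linear_injective_0[OF linear_W_con] by blast

section \<open>The simplex, the graph Laplacian and the conclusion\<close>

lemma convex_Delta: "convex Delta"
  unfolding convex_def Delta_def
  by (auto simp: sum.distrib simp flip: sum_distrib_left)

lemma compact_Delta: "compact (Delta :: (real^'n) set)"
proof -
  have "Delta = {p :: real^'n. (\<Sum>i\<in>UNIV. p $ i) = 1} \<inter> (\<Inter>i. {p. 0 \<le> p $ i})"
    by (auto simp: Delta_def)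
  also have "closed \<dots>"
    by (intro closed_Int closed_INT ballI closed_Collect_eq closed_Collect_le continuous_intros)
  finally have "closed (Delta :: (real^'n) set)" .
  moreover have "p \<in> cbox 0 1" if "p \<in> Delta" for p :: "real^'n"
  proof -
    have "p $ i \<le> (\<Sum>i\<in>UNIV. p $ i)" for i
      using that by (intro member_le_sum) (auto simp: Delta_def)
    then show ?thesis
      using that by (simp add: Delta_def mem_box_cart)
  qed
  ultimately show ?thesis
    using compact_Int_closed[OF compact_cbox[of 0 "1 :: real^'n"]]
    by (metis inf.absorb_iff2 subsetI)
qed

text \<open>Symmetry of the Laplacian is what makes the Gramian injective in the weights.\<close>

lemma symmetric_graph_laplacian:
  assumes "pair_graph G" "edge_weights G w"
  shows "transpose (graph_laplacian G w) = graph_laplacian G w"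
proof -
  interpret pair_graph G by fact
  have "(i, j) \<in> parcs G \<longleftrightarrow> (j, i) \<in> parcs G" for i j
    using arcs_symmetric by blast
  moreover have "w i j = w j i" if "(i, j) \<in> parcs G" for i j
    using assms(2) that by (auto simp: edge_weights_def)
  ultimately show ?thesis
    by (auto simp: vec_eq_iff transpose_def graph_laplacian_def)
qed

theorem theorem5:
  fixes G :: "'n::finite pair_pre_digraph" and w :: "'n \<Rightarrow> 'n \<Rightarrow> real"
    and L A :: "real^'n^'n" and T :: real
  assumes "pair_graph G" and "pverts G = UNIV" and "Digraph_Component.connected (with_proj G)"
    and "edge_weights G w"
    and "L = graph_laplacian G w"
    and "A = - L"
    and "T > 0"
  shows "(\<exists>!p. p \<in> X_T A T \<inter> Delta \<and> (\<forall>q \<in> X_T A T \<inter> Delta. f_T A T p \<le> f_T A T q)) \<and>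
         (\<exists>!p. p \<in> X_T A T \<inter> Delta \<and> (\<forall>q \<in> X_T A T \<inter> Delta. g_T A T p \<le> g_T A T q))"
proof -
  have "transpose L = L"
    using symmetric_graph_laplacian assms by blast
  then have sym: "transpose A = A"
    using assms(6) by (simp add: vec_eq_iff transpose_def)
  interpret semidefinite_family "\<lambda>p. W_con A p T" Delta
  proof (intro semidefinite_family.intro linear_W_con inj_W_con sym \<open>T > 0\<close>
      convex_Delta compact_Delta)
    \<comment> \<open>The barycenter of the simplex has only positive weights, so its Gramian is
      definite and the feasible set is nonempty.\<close>
    let ?p = "\<chi> i. 1 / real CARD('n) :: real^'n"
    have "?p \<in> Delta"
      by (simp add: Delta_def)
    moreover have "positive_definite (W_con A ?p T)"
      by (intro positive_definite_W_con assms) simp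
    ultimately show "\<exists>p\<in>Delta. positive_definite (W_con A p T)"
      by blast
  qed (simp add: Delta_def positive_semidefinite_W_con)
  have "definite_part = X_T A T \<inter> Delta"
    by (auto simp: X_T_def)
  then show ?thesis
    using unique_minimizer_neg_ln_det unique_minimizer_trace_inv
    by (simp add: f_T_def g_T_def)
qed

end
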